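(* (1) Let $G$ and $H$ be graphs such that the join $G\vee H$ is not a complete graph. Then $pvc(G\vee H)=spvc(G\vee H)=1$. (2) Let $G,H$ be two graphs and let $k$ be an integer with $2\leq k\leq \min\{|V(G)|,|V(H)|\}$. If $\delta(G)+\delta(H)<k-1$, where $\delta$ denotes the minimum degree, then $pvc_k(G\vee H)=2$; otherwise $pvc_k(G\vee H)=1$.
   Context: All graphs are simple, finite and undirected. The join $G\vee H$ has vertex set $V(G)\cup V(H)$ (disjoint union) and edge set $E(G)\cup E(H)\cup\{uv: u\in V(G), v\in V(H)\}$. A set of paths between two vertices is called disjoint if the paths are internally vertex-disjoint. In a vertex-colored graph, a path is vertex-proper if any two adjacent internal vertices of the path receive different colors. A vertex-colored graph is proper vertex $k$-connected if any two vertices are joined by $k$ disjoint vertex-proper paths. For a $k$-connected graph $G$, $pvc_k(G)$ is the smallest number of colors in a vertex-coloring making $G$ proper vertex $k$-connected; $pvc(G)=pvc_1(G)$, with the convention $pvc(G)=0$ for a complete graph $G$ (for $k\ge 2$, a coloring uses at least one color, so $pvc_k(G)\ge1$). A $u$-$v$ geodesic is a $u$-$v$ path of length equal to the distance $d(u,v)$. A vertex-colored graph is strong proper vertex-connected if for any two vertices $u,v$ there is a vertex-proper $u$-$v$ geodesic; $spvc(G)$ is the smallest number of colors needed for this, with $spvc(G)=0$ for a complete graph $G$. *)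

theory Defs
  imports "Graph_Theory.Graph_Theory"
begin

text \<open>
  A simple, finite, undirected graph is a \<^locale>\<open>pair_graph\<close>: each edge is represented by
  its two opposite arcs. A path is given by its list of arcs (\<^const>\<open>pre_digraph.apath\<close>);
  between two given distinct vertices, these lists correspond one-to-one to the undirected paths.
\<close>

definition graph_join ::
  "'a pair_pre_digraph \<Rightarrow> 'b pair_pre_digraph \<Rightarrow> ('a + 'b) pair_pre_digraph" where
  "graph_join G H = \<lparr>
     pverts = pverts G <+> pverts H,
     parcs = map_prod Inl Inl ` parcs G \<union> map_prod Inr Inr ` parcs H
       \<union> Inl ` pverts G \<times> Inr ` pverts H \<union> Inr ` pverts H \<times> Inl ` pverts G \<rparr>"

lemma pair_graph_graph_join:
  assumes "pair_graph G" "pair_graph H"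
  shows "pair_graph (graph_join G H)"
proof -
  interpret G: pair_graph G by fact
  interpret H: pair_graph H by fact
  show ?thesis
  proof unfold_locales
    show "symmetric (with_proj (graph_join G H))"
      by (auto simp: symmetric_def graph_join_def intro!: symI
          intro: G.arcs_symmetric H.arcs_symmetric rev_image_eqI)
  qed (auto simp: graph_join_def dest: G.arc_fst_in_verts G.arc_snd_in_verts
      H.arc_fst_in_verts H.arc_snd_in_verts G.no_loops' H.no_loops')
qed

definition complete_graph :: "'a pair_pre_digraph \<Rightarrow> bool" where
  "complete_graph G \<longleftrightarrow> complete_digraph (card (pverts G)) (with_proj G)"

text \<open>In a symmetric digraph the out-degree of a vertex is its undirected degree.\<close>

definition min_degree :: "'a pair_pre_digraph \<Rightarrow> nat" where
  "min_degree G = Min (out_degree (with_proj G) ` pverts G)"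

definition k_connected :: "nat \<Rightarrow> 'a pair_pre_digraph \<Rightarrow> bool" where
  "k_connected k G \<longleftrightarrow> k < card (pverts G) \<and>
     (\<forall>S \<subseteq> pverts G. card S < k \<longrightarrow>
        Digraph_Component.connected (with_proj G \<restriction> (pverts G - S)))"

definition vertex_proper_path ::
  "'a pair_pre_digraph \<Rightarrow> ('a \<Rightarrow> nat) \<Rightarrow> 'a \<Rightarrow> ('a \<times> 'a) list \<Rightarrow> 'a \<Rightarrow> bool" where
  "vertex_proper_path G c u p v \<longleftrightarrow> pre_digraph.apath (with_proj G) u p v \<and>
     distinct_adj (map c (pre_digraph.inner_verts (with_proj G) p))"

definition internally_disjoint ::
  "'a pair_pre_digraph \<Rightarrow> ('a \<times> 'a) list \<Rightarrow> ('a \<times> 'a) list \<Rightarrow> bool" where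
  "internally_disjoint G p q \<longleftrightarrow>
     set (pre_digraph.inner_verts (with_proj G) p) \<inter> set (pre_digraph.inner_verts (with_proj G) q) = {}"

definition proper_vertex_k_connected ::
  "nat \<Rightarrow> 'a pair_pre_digraph \<Rightarrow> ('a \<Rightarrow> nat) \<Rightarrow> bool" where
  "proper_vertex_k_connected k G c \<longleftrightarrow>
     (\<forall>u \<in> pverts G. \<forall>v \<in> pverts G. u \<noteq> v \<longrightarrow>
        (\<exists>P. finite P \<and> card P = k \<and> (\<forall>p \<in> P. vertex_proper_path G c u p v) \<and>
             pairwise (internally_disjoint G) P))"

text \<open>
  The numbers below are defined only on k-connected (respectively connected) graphs;
  elsewhere they are left unspecified.
\<close>

definition pvc_k :: "nat \<Rightarrow> 'a pair_pre_digraph \<Rightarrow> nat" where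
  "pvc_k k G =
     (if k_connected k G
      then LEAST n. \<exists>c. proper_vertex_k_connected k G c \<and> card (c ` pverts G) = n
      else undefined)"

definition pvc :: "'a pair_pre_digraph \<Rightarrow> nat" where
  "pvc G = (if complete_graph G then 0 else pvc_k 1 G)"

text \<open>The distance of two vertices is \<^const>\<open>wf_digraph.\<mu>\<close> for unit arc weights.\<close>

definition geodesic ::
  "'a pair_pre_digraph \<Rightarrow> 'a \<Rightarrow> ('a \<times> 'a) list \<Rightarrow> 'a \<Rightarrow> bool" where
  "geodesic G u p v \<longleftrightarrow> pre_digraph.apath (with_proj G) u p v \<and>
     ereal (real (length p)) = wf_digraph.\<mu> (with_proj G) (\<lambda>_. 1) u v"

definition strong_proper_vertex_connected ::
  "'a pair_pre_digraph \<Rightarrow> ('a \<Rightarrow> nat) \<Rightarrow> bool" where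
  "strong_proper_vertex_connected G c \<longleftrightarrow>
     (\<forall>u \<in> pverts G. \<forall>v \<in> pverts G. u \<noteq> v \<longrightarrow>
        (\<exists>p. geodesic G u p v \<and> vertex_proper_path G c u p v))"

definition spvc :: "'a pair_pre_digraph \<Rightarrow> nat" where
  "spvc G =
     (if complete_graph G then 0
      else if Digraph_Component.connected (with_proj G)
      then LEAST n. \<exists>c. strong_proper_vertex_connected G c \<and> card (c ` pverts G) = n
      else undefined)"

end

theory Submission
  imports Defs
begin

text \<open>
  With a single color the vertex-proper paths are those with at most one internal vertex, so two
  vertices are joined by as many disjoint ones as they have common neighbors, plus one if they are
  adjacent. In a join, two vertices on the same side have the whole other side as common
  neighbors, while \<open>u\<close> in \<open>G\<close> and \<open>v\<close> in \<open>H\<close> are adjacent and have \<open>deg u + deg v\<close>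
  common neighbors. Hence one color suffices iff the two minimum degrees sum to at least
  \<open>k - 1\<close>. Otherwise color the two sides differently and join \<open>u\<close> to \<open>v\<close> by the edge and by
  \<open>k - 1\<close> paths \<open>u, x, y, v\<close> along a matching between \<open>V(H) - {v}\<close> and \<open>V(G) - {u}\<close>.
\<close>

section \<open>Disjoint proper paths between one pair of vertices\<close>

definition has_proper_paths ::
  "nat \<Rightarrow> 'a pair_pre_digraph \<Rightarrow> ('a \<Rightarrow> nat) \<Rightarrow> 'a \<Rightarrow> 'a \<Rightarrow> bool" where
  "has_proper_paths k G c u v \<longleftrightarrow>
     (\<exists>P. finite P \<and> card P = k \<and> (\<forall>p \<in> P. vertex_proper_path G c u p v) \<and>
          pairwise (internally_disjoint G) P)"

lemma proper_vertex_k_connected_iff: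
  "proper_vertex_k_connected k G c \<longleftrightarrow>
     (\<forall>u \<in> pverts G. \<forall>v \<in> pverts G. u \<noteq> v \<longrightarrow> has_proper_paths k G c u v)"
  by (simp add: proper_vertex_k_connected_def has_proper_paths_def)

lemma has_proper_pathsI:
  assumes "finite P" "k \<le> card P" "\<And>p. p \<in> P \<Longrightarrow> vertex_proper_path G c u p v"
    "pairwise (internally_disjoint G) P"
  shows "has_proper_paths k G c u v"
proof -
  obtain Q where "Q \<subseteq> P" "card Q = k"
    using obtain_subset_with_card_n[OF assms(2)] by metis
  then show ?thesis
    using assms finite_subset pairwise_subset unfolding has_proper_paths_def by (metis subsetD)
qed

text \<open>The arcs are oriented from \<open>u\<close> to \<open>v\<close>, so that each element is
  directly the midpoint of a two-arc path.\<close>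

definition common_nbrs :: "'a pair_pre_digraph \<Rightarrow> 'a \<Rightarrow> 'a \<Rightarrow> 'a set" where
  "common_nbrs G u v = {w. (u, w) \<in> parcs G \<and> (w, v) \<in> parcs G}"

section \<open>Short paths, bipartite detours and geodesics in an arbitrary graph\<close>

context pair_graph
begin

lemma finite_common_nbrs: "finite (common_nbrs G u v)"
  by (rule finite_subset[OF _ pair_finite_verts])
    (auto simp: common_nbrs_def dest: in_arcsD1)

lemma common_nbrs_commute: "common_nbrs G u v = common_nbrs G v u"
  by (auto simp: common_nbrs_def intro: arcs_symmetric)

lemma vertex_proper_path1:
  "(u, v) \<in> parcs G \<Longrightarrow> vertex_proper_path G c u [(u, v)] v"
  by (auto simp: vertex_proper_path_def apath_simps inner_verts_with_proj_def
      dest: no_loops' in_arcsD2)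

lemma vertex_proper_path2:
  "\<lbrakk>w \<in> common_nbrs G u v; u \<noteq> v\<rbrakk> \<Longrightarrow> vertex_proper_path G c u [(u, w), (w, v)] v"
  by (auto simp: vertex_proper_path_def apath_simps inner_verts_with_proj_def common_nbrs_def
      dest: no_loops' in_arcsD2)

lemma vertex_proper_path3:
  "\<lbrakk>(u, x) \<in> parcs G; (x, y) \<in> parcs G; (y, v) \<in> parcs G; distinct [u, x, y, v]; c x \<noteq> c y\<rbrakk>
    \<Longrightarrow> vertex_proper_path G c u [(u, x), (x, y), (y, v)] v"
  by (auto simp: vertex_proper_path_def apath_simps inner_verts_with_proj_def
      dest: in_arcsD2)

lemma monochromatic_path_cases:
  assumes p: "vertex_proper_path G c u p v" and "u \<noteq> v"
    and c: "\<And>x y. \<lbrakk>x \<in> pverts G; y \<in> pverts G\<rbrakk> \<Longrightarrow> c x = c y"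
  obtains "p = [(u, v)]" "(u, v) \<in> parcs G"
  | w where "w \<in> common_nbrs G u v" "p = [(u, w), (w, v)]"
proof -
  have ap: "apath u p v" and d: "distinct_adj (map c (tl (map fst p)))"
    using p by (auto simp: vertex_proper_path_def inner_verts_with_proj_def)
  obtain e q where pe: "p = e # q"
    using ap \<open>u \<noteq> v\<close> by (cases p) (auto simp: apath_simps)
  show thesis
  proof (cases q)
    case Nil
    then show thesis using ap pe that(1) by (cases e) (auto simp: apath_simps)
  next
    case (Cons f r)
    \<comment> \<open>A third arc \<open>g\<close> would make \<open>fst f\<close> and
      \<open>fst g\<close> consecutive internal vertices of equal color.\<close>
    have "r = []"
    proof (cases r)
      case (Cons g s)
      then have "c (fst f) = c (fst g)"
        using ap pe \<open>q = f # r\<close> by (intro c) (auto simp: apath_simps arc_fst_in_verts)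
      then show ?thesis using d pe \<open>q = f # r\<close> Cons by simp
    qed
    then show thesis using ap pe Cons that(2)[of "snd e"]
      by (cases e; cases f) (auto simp: apath_simps common_nbrs_def)
  qed
qed

text \<open>Paths with at most one internal vertex are proper under every coloring, so
  \<open>c\<close> is arbitrary here.\<close>

lemma has_proper_paths_common_nbrsI:
  assumes "u \<noteq> v" and k: "k \<le> card (common_nbrs G u v) + of_bool ((u, v) \<in> parcs G)"
  shows "has_proper_paths k G c u v"
proof -
  let ?D = "if (u, v) \<in> parcs G then {[(u, v)]} else {}"
  let ?f = "\<lambda>w. [(u, w), (w, v)]"
  let ?P = "?D \<union> ?f ` common_nbrs G u v"
  have "card ?P = card ?D + card (?f ` common_nbrs G u v)"
    by (rule card_Un_disjoint) (auto simp: finite_common_nbrs)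
  moreover have "card (?f ` common_nbrs G u v) = card (common_nbrs G u v)"
    by (rule card_image) (auto simp: inj_on_def)
  ultimately have "k \<le> card ?P" using k by (simp split: if_splits)
  then show ?thesis
    by (rule has_proper_pathsI[rotated])
      (use \<open>u \<noteq> v\<close> in \<open>auto simp: finite_common_nbrs vertex_proper_path1 vertex_proper_path2
        pairwise_def internally_disjoint_def inner_verts_with_proj_def split: if_splits\<close>)
qed

text \<open>Each path of the family is the edge or is determined by its midpoint; the
  \<open>+ 1\<close> accounts for the edge.\<close>

lemma monochromatic_has_proper_pathsD:
  assumes "has_proper_paths k G c u v" "u \<noteq> v"
    and c: "\<And>x y. \<lbrakk>x \<in> pverts G; y \<in> pverts G\<rbrakk> \<Longrightarrow> c x = c y"
  shows "k \<le> card (common_nbrs G u v) + 1"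
proof -
  obtain P where P: "card P = k" "\<And>p. p \<in> P \<Longrightarrow> vertex_proper_path G c u p v"
    using assms(1) by (auto simp: has_proper_paths_def)
  let ?f = "\<lambda>w. [(u, w), (w, v)]"
  have "P \<subseteq> insert [(u, v)] (?f ` common_nbrs G u v)"
    using monochromatic_path_cases[OF P(2) \<open>u \<noteq> v\<close> c] by blast
  then have "k \<le> card (insert [(u, v)] (?f ` common_nbrs G u v))"
    unfolding P(1)[symmetric] by (intro card_mono) (simp_all add: finite_common_nbrs)
  also have "\<dots> \<le> Suc (card (?f ` common_nbrs G u v))"
    by (simp add: card_insert_if finite_common_nbrs)
  also have "\<dots> \<le> card (common_nbrs G u v) + 1"
    using card_image_le[OF finite_common_nbrs] by simp
  finally show ?thesis .
qed

text \<open>Meant for \<open>u\<close> and \<open>v\<close> on opposite sides of a join: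
  \<open>A\<close> is the side of \<open>v\<close> without \<open>v\<close>, and \<open>B\<close>
  the side of \<open>u\<close> without \<open>u\<close>. The edge and \<open>k - 1\<close> detours
  along a matching of \<open>A\<close> with \<open>B\<close> form the family.\<close>

lemma has_proper_paths_bipartiteI:
  assumes "(u, v) \<in> parcs G" "finite A" "finite B" "k \<le> Suc (card A)" "k \<le> Suc (card B)"
    and A: "\<And>x. x \<in> A \<Longrightarrow> (u, x) \<in> parcs G \<and> x \<noteq> v"
    and B: "\<And>y. y \<in> B \<Longrightarrow> (y, v) \<in> parcs G \<and> y \<noteq> u"
    and AB: "\<And>x y. \<lbrakk>x \<in> A; y \<in> B\<rbrakk> \<Longrightarrow> (x, y) \<in> parcs G \<and> c x \<noteq> c y"
  shows "has_proper_paths k G c u v"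
proof -
  obtain A' where A': "A' \<subseteq> A" "card A' = k - 1" "finite A'"
    using obtain_subset_with_card_n[of "k - 1" A] assms(2,4) finite_subset
    by (metis diff_Suc_1 diff_le_mono)
  obtain B' where B': "B' \<subseteq> B" "card B' = k - 1" "finite B'"
    using obtain_subset_with_card_n[of "k - 1" B] assms(3,5) finite_subset
    by (metis diff_Suc_1 diff_le_mono)
  \<comment> \<open>Both sets were cut down to \<open>k - 1\<close> elements so that a perfect
    matching \<open>g\<close> between them exists.\<close>
  obtain g where g: "bij_betw g A' B'"
    using finite_same_card_bij A' B' by metis
  let ?f = "\<lambda>x. [(u, x), (x, g x), (g x, v)]"
  let ?P = "insert [(u, v)] (?f ` A')"
  have gB: "g x \<in> B" if "x \<in> A'" for x using g that B'(1) by (auto simp: bij_betw_def)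
  have "card (?f ` A') = k - 1"
    using A'(2) by (subst card_image) (auto simp: inj_on_def)
  then have card: "k \<le> card ?P"
    using A'(3) by (subst card_insert_disjoint) auto
  have paths: "vertex_proper_path G c u p v" if "p \<in> ?P" for p
    using that
  proof
    assume "p \<in> ?f ` A'"
    then obtain x where x: "x \<in> A'" "p = ?f x" by blast
    have "x \<in> A" using x A' by blast
    then show ?thesis
      unfolding x(2) using A[of x] B[OF gB] AB[OF _ gB] x(1) assms(1)
      by (intro vertex_proper_path3) (auto dest: no_loops')
  qed (simp add: assms(1) vertex_proper_path1)
  have "pairwise (internally_disjoint G) ?P"
  proof -
    \<comment> \<open>\<open>A\<close> and \<open>B\<close> are disjoint: a shared vertex would
      carry a loop, as every vertex of \<open>A\<close> is adjacent to all of
      \<open>B\<close>.\<close>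
    have "g x \<noteq> y" if "x \<in> A'" "y \<in> A'" for x y
      using AB[OF _ gB, of y x] A'(1) that no_loops' by blast
    moreover have "g x = g y \<longleftrightarrow> x = y" if "x \<in> A'" "y \<in> A'" for x y
      using g that by (auto simp: bij_betw_def inj_on_def)
    ultimately show ?thesis
      by (auto simp: pairwise_def internally_disjoint_def inner_verts_with_proj_def)
  qed
  then show ?thesis using has_proper_pathsI[OF _ card paths] A'(3) by blast
qed

text \<open>\<open>\<mu>\<close> is an infimum over all walks, so minimality is required among walks
  and not only among paths.\<close>

lemma geodesicI:
  assumes p: "apath u p v"
    and min: "\<And>q. awalk u q v \<Longrightarrow> length p \<le> length q"
  shows "geodesic G u p v"
proof -
  have cost: "awalk_cost (\<lambda>_. 1) q = real (length q)" for q :: "('a \<times> 'a) awalk"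
    by (induct q) auto
  have "\<mu> (\<lambda>_. 1) u v = ereal (real (length p))"
  proof (rule antisym)
    show "\<mu> (\<lambda>_. 1) u v \<le> ereal (real (length p))"
      using min_cost_le_walk_cost[OF awalkI_apath[OF p], of "\<lambda>_. 1"] by (simp add: cost)
    show "ereal (real (length p)) \<le> \<mu> (\<lambda>_. 1) u v"
      unfolding \<mu>_def by (rule INF_greatest) (auto simp: cost dest: min)
  qed
  then show ?thesis using p by (simp add: geodesic_def)
qed

text \<open>Under this hypothesis distances are at most 2, so geodesics have at most one internal
  vertex and are proper under every coloring.\<close>

lemma strong_proper_vertex_connectedI:
  assumes "\<And>u v. \<lbrakk>u \<in> pverts G; v \<in> pverts G; u \<noteq> v; (u, v) \<notin> parcs G\<rbrakk>
    \<Longrightarrow> common_nbrs G u v \<noteq> {}"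
  shows "strong_proper_vertex_connected G c"
  unfolding strong_proper_vertex_connected_def
proof (intro ballI impI)
  fix u v assume uv: "u \<in> pverts G" "v \<in> pverts G" "u \<noteq> v"
  have nonempty: "1 \<le> length q" if "awalk u q v" for q
    using that uv(3) by (cases q) (auto simp: awalk_simps)
  show "\<exists>p. geodesic G u p v \<and> vertex_proper_path G c u p v"
  proof (cases "(u, v) \<in> parcs G")
    case True
    note p = vertex_proper_path1[OF this]
    then have "geodesic G u [(u, v)] v"
      by (intro geodesicI) (auto simp: vertex_proper_path_def dest: nonempty)
    then show ?thesis using p by blast
  next
    case False
    then obtain w where "w \<in> common_nbrs G u v" using assms uv by blast
    note p = vertex_proper_path2[OF this uv(3)]
    have min: "2 \<le> length q" if q: "awalk u q v" for q
    proof (rule ccontr)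
      assume "\<not> 2 \<le> length q"
      then obtain e where "q = [e]" using nonempty[OF q] by (cases q; cases "tl q") auto
      then show False using q False by (cases e) (auto simp: awalk_simps)
    qed
    have "geodesic G u [(u, w), (w, v)] v"
      using p by (intro geodesicI) (auto simp: vertex_proper_path_def dest: min)
    then show ?thesis using p by blast
  qed
qed

end

lemma card_constant_colors: "V \<noteq> {} \<Longrightarrow> card ((\<lambda>_. 0 :: nat) ` V) = 1"
  by (simp add: image_constant_conv)

lemma pvc_k_eqI:
  assumes "k_connected k G" "proper_vertex_k_connected k G c" "card (c ` pverts G) = n"
    and "\<And>c. proper_vertex_k_connected k G c \<Longrightarrow> n \<le> card (c ` pverts G)"
  shows "pvc_k k G = n"
  unfolding pvc_k_def using assms by (auto intro!: Least_equality)

section \<open>Structure and connectivity of the join\<close>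

lemma pverts_graph_join [simp]: "pverts (graph_join G H) = pverts G <+> pverts H"
  by (simp add: graph_join_def)

lemma parcs_graph_join [simp]:
  "(Inl a, Inl b) \<in> parcs (graph_join G H) \<longleftrightarrow> (a, b) \<in> parcs G"
  "(Inr x, Inr y) \<in> parcs (graph_join G H) \<longleftrightarrow> (x, y) \<in> parcs H"
  "(Inl a, Inr y) \<in> parcs (graph_join G H) \<longleftrightarrow> a \<in> pverts G \<and> y \<in> pverts H"
  "(Inr y, Inl a) \<in> parcs (graph_join G H) \<longleftrightarrow> a \<in> pverts G \<and> y \<in> pverts H"
  by (auto simp: graph_join_def)

locale graph_pair = G: pair_graph G + H: pair_graph H
  for G :: "'a pair_pre_digraph" and H :: "'b pair_pre_digraph"
begin

abbreviation J where "J \<equiv> graph_join G H"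

sublocale J: pair_graph J
  by (intro pair_graph_graph_join G.pair_graph H.pair_graph)

text \<open>Left vertices reach \<open>Inl a\<close> through \<open>Inr b\<close>, right vertices
  are adjacent to \<open>Inl a\<close>. Induced subgraphs are treated because
  \<open>k_connected\<close> deletes vertex sets.\<close>

lemma connected_induce_join:
  assumes a: "Inl a \<in> V" and b: "Inr b \<in> V" and V: "V \<subseteq> pverts J"
  shows "Digraph_Component.connected (with_proj J \<restriction> V)"
proof -
  interpret K: wf_digraph "with_proj J \<restriction> V"
    by (rule J.wellformed_induce_subgraph)
  have arc: "x \<rightarrow>\<^bsub>with_proj J \<restriction> V\<^esub> y" if "x \<in> V" "y \<in> V" "(x, y) \<in> parcs J" for x y
    using that by (force simp: arcs_ends_conv)
  have mixed: "Inl x \<rightarrow>\<^bsub>with_proj J \<restriction> V\<^esub> Inr y \<and> Inr y \<rightarrow>\<^bsub>with_proj J \<restriction> V\<^esub> Inl x"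
    if "Inl x \<in> V" "Inr y \<in> V" for x y
    using that V by (auto intro!: arc)
  have to: "x \<rightarrow>\<^sup>*\<^bsub>with_proj J \<restriction> V\<^esub> Inl a" if "x \<in> V" for x
  proof (cases x)
    case (Inl c)
    then show ?thesis
      using mixed[of c b] mixed[OF a b] b that by (metis K.reachable_adjI K.reachable_trans)
  qed (use that mixed[OF a] in auto)
  have out: "Inl a \<rightarrow>\<^sup>*\<^bsub>with_proj J \<restriction> V\<^esub> x" if "x \<in> V" for x
  proof (cases x)
    case (Inl c)
    then show ?thesis
      using mixed[of c b] mixed[OF a b] b that by (metis K.reachable_adjI K.reachable_trans)
  qed (use that mixed[OF a] in auto)
  show ?thesis
    by (rule K.connectedI)
      (use a to out in \<open>auto intro: K.reachable_mk_symmetricI K.reachable_trans\<close>)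
qed

lemma connected_join:
  assumes "pverts G \<noteq> {}" "pverts H \<noteq> {}"
  shows "Digraph_Component.connected (with_proj J)"
proof -
  have "with_proj J \<restriction> pverts J = with_proj J"
    using J.arc_fst_in_verts J.arc_snd_in_verts
    by (auto simp: induce_subgraph_def with_proj_def)
  then show ?thesis
    using assms connected_induce_join[of _ "pverts J"] by force
qed

text \<open>Deleting fewer than \<open>k\<close> vertices exhausts neither side, so the remaining
  vertices still meet both.\<close>

lemma k_connected_join:
  assumes "1 \<le> k" "k \<le> card (pverts G)" "k \<le> card (pverts H)"
  shows "k_connected k J"
  unfolding k_connected_def
proof (intro conjI allI impI)
  \<comment> \<open>The two sides have at least \<open>2 * k\<close> vertices together, which
    exceeds \<open>k\<close> because \<open>1 \<le> k\<close>.\<close>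
  show "k < card (pverts J)"
    using assms by (simp add: card_Plus G.pair_finite_verts H.pair_finite_verts)
next
  fix S assume S: "S \<subseteq> pverts J" "card S < k"
  have "finite S" using S(1) J.pair_finite_verts finite_subset by blast
  have "\<exists>x \<in> pverts G. Inl x \<notin> S"
  proof (rule ccontr)
    assume "\<not> ?thesis"
    then have "card (Inl ` pverts G :: ('a + 'b) set) \<le> card S"
      using \<open>finite S\<close> by (intro card_mono) auto
    then show False using S(2) assms(2) by (simp add: card_image)
  qed
  moreover have "\<exists>y \<in> pverts H. Inr y \<notin> S"
  proof (rule ccontr)
    assume "\<not> ?thesis"
    then have "card (Inr ` pverts H :: ('a + 'b) set) \<le> card S"
      using \<open>finite S\<close> by (intro card_mono) auto
    then show False using S(2) assms(3) by (simp add: card_image)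
  qed
  ultimately show "Digraph_Component.connected (with_proj J \<restriction> (pverts J - S))"
    by (auto intro!: connected_induce_join)
qed

section \<open>Counting common neighbors in the join\<close>

lemma card_common_nbrs_Inl:
  assumes "a \<in> pverts G" "b \<in> pverts G"
  shows "card (pverts H) \<le> card (common_nbrs J (Inl a) (Inl b))"
proof -
  have "card (Inr ` pverts H :: ('a + 'b) set) \<le> card (common_nbrs J (Inl a) (Inl b))"
    by (intro card_mono J.finite_common_nbrs) (use assms in \<open>auto simp: common_nbrs_def\<close>)
  then show ?thesis by (simp add: card_image)
qed

lemma card_common_nbrs_Inr:
  assumes "x \<in> pverts H" "y \<in> pverts H"
  shows "card (pverts G) \<le> card (common_nbrs J (Inr x) (Inr y))"
proof -
  have "card (Inl ` pverts G :: ('a + 'b) set) \<le> card (common_nbrs J (Inr x) (Inr y))"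
    by (intro card_mono J.finite_common_nbrs) (use assms in \<open>auto simp: common_nbrs_def\<close>)
  then show ?thesis by (simp add: card_image)
qed

text \<open>A vertex of \<open>G\<close> is adjacent to \<open>Inr y\<close> anyway, so it is a
  common neighbor iff it is adjacent to \<open>a\<close>; the case of \<open>H\<close> is
  symmetric.\<close>

lemma card_common_nbrs_mixed:
  assumes "a \<in> pverts G" "y \<in> pverts H"
  shows "card (common_nbrs J (Inl a) (Inr y)) = out_degree (with_proj G) a + out_degree (with_proj H) y"
proof -
  \<comment> \<open>The second set is written with arcs into \<open>y\<close>, as in
    \<open>common_nbrs\<close>; symmetry turns out-neighbors into in-neighbors.\<close>
  have nbrs: "snd ` out_arcs G a = {x. (a, x) \<in> parcs G}"
    "snd ` out_arcs H y = {z. (z, y) \<in> parcs H}"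
    using H.arcs_symmetric by (force simp: out_arcs_def)+
  have "common_nbrs J (Inl a) (Inr y) = snd ` out_arcs G a <+> snd ` out_arcs H y" (is "?L = ?R")
  proof (rule set_eqI)
    fix w show "w \<in> ?L \<longleftrightarrow> w \<in> ?R"
      using assms
      by (cases w) (auto simp: common_nbrs_def nbrs dest: G.in_arcsD2 H.in_arcsD1)
  qed
  moreover have "inj_on snd (out_arcs G a)" "inj_on snd (out_arcs H y)"
    by (auto simp: inj_on_def out_arcs_def)
  ultimately show ?thesis
    by (simp add: card_Plus card_image out_degree_def G.finite_out_arcs H.finite_out_arcs)
qed

lemma min_degree_le_common_nbrs:
  "a \<in> pverts G \<Longrightarrow> y \<in> pverts H \<Longrightarrow>
    min_degree G + min_degree H \<le> card (common_nbrs J (Inl a) (Inr y))"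
  unfolding card_common_nbrs_mixed min_degree_def
  by (intro add_mono Min_le) (simp_all add: G.pair_finite_verts H.pair_finite_verts)

text \<open>The two minima are attained independently, so one mixed pair realizes their sum.\<close>

lemma min_degree_attained:
  assumes "pverts G \<noteq> {}" "pverts H \<noteq> {}"
  obtains a y where "a \<in> pverts G" "y \<in> pverts H"
    "card (common_nbrs J (Inl a) (Inr y)) = min_degree G + min_degree H"
proof -
  have "min_degree G \<in> out_degree (with_proj G) ` pverts G"
    unfolding min_degree_def by (rule Min_in) (use assms G.pair_finite_verts in auto)
  moreover have "min_degree H \<in> out_degree (with_proj H) ` pverts H"
    unfolding min_degree_def by (rule Min_in) (use assms H.pair_finite_verts in auto)
  ultimately show thesis using that by (auto simp: card_common_nbrs_mixed elim!: imageE)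
qed

section \<open>Colorings of the join\<close>

text \<open>Pairs on one side have the whole opposite side as common neighbors, hence only mixed
  pairs are left. Both orders occur because paths are directed arc lists.\<close>

lemma proper_vertex_k_connected_joinI:
  assumes "k \<le> card (pverts G)" "k \<le> card (pverts H)"
    and mixed: "\<And>a y. \<lbrakk>a \<in> pverts G; y \<in> pverts H\<rbrakk> \<Longrightarrow>
      has_proper_paths k J c (Inl a) (Inr y) \<and> has_proper_paths k J c (Inr y) (Inl a)"
  shows "proper_vertex_k_connected k J c"
  unfolding proper_vertex_k_connected_iff
proof (intro ballI impI)
  fix u v assume uv: "u \<in> pverts J" "v \<in> pverts J" "u \<noteq> v"
  show "has_proper_paths k J c u v"
  proof (cases "isl u = isl v")
    case True
    have "k \<le> card (common_nbrs J u v)"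
    proof (cases u)
      case (Inl a)
      then obtain b where "v = Inl b" using True by (cases v) auto
      then show ?thesis using Inl uv assms(2) card_common_nbrs_Inl[of a b] by auto
    next
      case (Inr x)
      then obtain y where "v = Inr y" using True by (cases v) auto
      then show ?thesis using Inr uv assms(1) card_common_nbrs_Inr[of x y] by auto
    qed
    then show ?thesis using uv(3) by (intro J.has_proper_paths_common_nbrsI) simp_all
  next
    case False
    then show ?thesis using uv mixed by (cases u; cases v) auto
  qed
qed

text \<open>Only the edge and paths through common neighbors are needed, so the coloring is
  arbitrary; it is later taken to be constant.\<close>

lemma proper_vertex_k_connected_join_constant:
  assumes "k \<le> card (pverts G)" "k \<le> card (pverts H)" "k \<le> min_degree G + min_degree H + 1"
  shows "proper_vertex_k_connected k J c"
proof (rule proper_vertex_k_connected_joinI[OF assms(1,2)])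
  fix a y assume ay: "a \<in> pverts G" "y \<in> pverts H"
  show "has_proper_paths k J c (Inl a) (Inr y) \<and> has_proper_paths k J c (Inr y) (Inl a)"
    using min_degree_le_common_nbrs[OF ay] ay assms(3) J.common_nbrs_commute[of "Inl a" "Inr y"]
    by (auto intro!: J.has_proper_paths_common_nbrsI)
qed

lemma proper_vertex_k_connected_join_two_colors:
  assumes "k \<le> card (pverts G)" "k \<le> card (pverts H)"
  shows "proper_vertex_k_connected k J (case_sum (\<lambda>_. 0) (\<lambda>_. 1))"
proof (rule proper_vertex_k_connected_joinI[OF assms(1,2)])
  fix a y assume ay: "a \<in> pverts G" "y \<in> pverts H"
  let ?A = "Inl ` (pverts G - {a}) :: ('a + 'b) set"
  let ?B = "Inr ` (pverts H - {y}) :: ('a + 'b) set"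
  have fin: "finite ?A" "finite ?B"
    by (simp_all add: G.pair_finite_verts H.pair_finite_verts)
  have card: "k \<le> Suc (card ?A)" "k \<le> Suc (card ?B)"
    using assms ay by (simp_all add: card_image card_Diff_singleton)
  show "has_proper_paths k J (case_sum (\<lambda>_. 0) (\<lambda>_. 1)) (Inl a) (Inr y) \<and>
      has_proper_paths k J (case_sum (\<lambda>_. 0) (\<lambda>_. 1)) (Inr y) (Inl a)"
  proof
    \<comment> \<open>Detours from \<open>Inl a\<close> enter the side of \<open>H\<close> first, so
      \<open>?B\<close> takes the role of \<open>A\<close>; hence the swapped indices.\<close>
    show "has_proper_paths k J (case_sum (\<lambda>_. 0) (\<lambda>_. 1)) (Inl a) (Inr y)"
      by (rule J.has_proper_paths_bipartiteI[OF _ fin(2,1) card(2,1)]) (use ay in auto)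
    show "has_proper_paths k J (case_sum (\<lambda>_. 0) (\<lambda>_. 1)) (Inr y) (Inl a)"
      by (rule J.has_proper_paths_bipartiteI[OF _ fin card]) (use ay in auto)
  qed
qed

text \<open>With a single color, a mixed pair of minimum degrees has at most
  \<open>min_degree G + min_degree H + 1\<close> proper paths, fewer than \<open>k\<close>.\<close>

lemma two_le_card_colors:
  assumes ne: "pverts G \<noteq> {}" "pverts H \<noteq> {}" and k: "min_degree G + min_degree H + 1 < k"
    and c: "proper_vertex_k_connected k J c"
  shows "2 \<le> card (c ` pverts J)"
proof (rule ccontr)
  assume less: "\<not> ?thesis"
  then have "card (c ` pverts J) \<le> Suc 0" by simp
  then have mono: "c x = c y" if "x \<in> pverts J" "y \<in> pverts J" for x y
    using that J.pair_finite_verts card_le_Suc0_iff_eq[of "c ` pverts J"] by blast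
  obtain a y where ay: "a \<in> pverts G" "y \<in> pverts H"
    "card (common_nbrs J (Inl a) (Inr y)) = min_degree G + min_degree H"
    using min_degree_attained[OF ne] .
  then have "has_proper_paths k J c (Inl a) (Inr y)"
    using c by (auto simp: proper_vertex_k_connected_iff)
  then have "k \<le> min_degree G + min_degree H + 1"
    using J.monochromatic_has_proper_pathsD[OF _ _ mono] ay(3) by fastforce
  then show False using k by simp
qed

lemma one_le_card_colors:
  assumes "pverts G \<noteq> {}"
  shows "1 \<le> card (c ` pverts J)"
  using assms J.pair_finite_verts by (simp add: Suc_le_eq card_gt_0_iff del: pverts_graph_join) simp

section \<open>Values of the connection numbers\<close>

lemma pvc_k_join_eq_1:
  assumes "1 \<le> k" "k \<le> card (pverts G)" "k \<le> card (pverts H)"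
    "k \<le> min_degree G + min_degree H + 1"
  shows "pvc_k k J = 1"
proof (rule pvc_k_eqI)
  have ne: "pverts G \<noteq> {}" using assms by auto
  show "k_connected k J" by (rule k_connected_join[OF assms(1-3)])
  show "proper_vertex_k_connected k J (\<lambda>_. 0)"
    by (rule proper_vertex_k_connected_join_constant[OF assms(2-4)])
  show "card ((\<lambda>_. 0 :: nat) ` pverts J) = 1"
    using ne by (intro card_constant_colors) auto
  show "1 \<le> card (c ` pverts J)" for c :: "'a + 'b \<Rightarrow> nat"
    by (rule one_le_card_colors[OF ne])
qed

lemma pvc_k_join_eq_2:
  assumes "k \<le> card (pverts G)" "k \<le> card (pverts H)" "min_degree G + min_degree H + 1 < k"
  shows "pvc_k k J = 2"
proof (rule pvc_k_eqI)
  have ne: "pverts G \<noteq> {}" "pverts H \<noteq> {}" using assms by auto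
  show "k_connected k J" using assms by (intro k_connected_join) auto
  show "proper_vertex_k_connected k J (case_sum (\<lambda>_. 0) (\<lambda>_. 1))"
    by (rule proper_vertex_k_connected_join_two_colors[OF assms(1,2)])
  have "case_sum (\<lambda>_. 0) (\<lambda>_. 1) ` pverts J = {0, 1 :: nat}"
    using ne by (force simp: image_iff)
  then show "card (case_sum (\<lambda>_. 0) (\<lambda>_. 1) ` pverts J :: nat set) = 2" by simp
  show "2 \<le> card (c ` pverts J)" if "proper_vertex_k_connected k J c" for c
    by (rule two_le_card_colors[OF ne assms(3) that])
qed

text \<open>For \<open>k = 1\<close> the degree condition of \<open>pvc_k_join_eq_1\<close> is
  trivial.\<close>

lemma pvc_join:
  assumes ne: "pverts G \<noteq> {}" "pverts H \<noteq> {}" and "\<not> complete_graph J"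
  shows "pvc J = 1"
proof -
  have "1 \<le> card (pverts G)" "1 \<le> card (pverts H)"
    using ne by (simp_all add: Suc_le_eq card_gt_0_iff G.pair_finite_verts H.pair_finite_verts)
  then show ?thesis using assms(3) pvc_k_join_eq_1[of 1] by (simp add: pvc_def)
qed

lemma spvc_join:
  assumes ne: "pverts G \<noteq> {}" "pverts H \<noteq> {}" and "\<not> complete_graph J"
  shows "spvc J = 1"
proof -
  obtain a y where ay: "a \<in> pverts G" "y \<in> pverts H" using ne by blast
  have "common_nbrs J u v \<noteq> {}"
    if "u \<in> pverts J" "v \<in> pverts J" "(u, v) \<notin> parcs J" for u v
  proof -
    \<comment> \<open>Nonadjacent vertices lie on the same side, so the chosen vertex of the other
      side is adjacent to both.\<close>
    have "Inr y \<in> common_nbrs J u v \<or> Inl a \<in> common_nbrs J u v"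
      using that ay by (cases u; cases v) (auto simp: common_nbrs_def)
    then show ?thesis by blast
  qed
  then have "strong_proper_vertex_connected J (\<lambda>_. 0)"
    by (intro J.strong_proper_vertex_connectedI) auto
  then have "(LEAST n. \<exists>c. strong_proper_vertex_connected J c \<and> card (c ` pverts J) = n) = 1"
    using card_constant_colors[of "pverts J"] one_le_card_colors[OF ne(1)] ne
    by (intro Least_equality) (blast | force)+
  then show ?thesis using assms connected_join by (simp add: spvc_def)
qed

end

theorem theorem2p1:
  fixes G :: "'a pair_pre_digraph" and H :: "'b pair_pre_digraph"
  assumes "pair_graph G" and "pair_graph H"
    and "pverts G \<noteq> {}" and "pverts H \<noteq> {}"
  shows "(\<not> complete_graph (graph_join G H) \<longrightarrow>
            pvc (graph_join G H) = 1 \<and> spvc (graph_join G H) = 1) \<and>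
         (\<forall>k. 2 \<le> k \<and> k \<le> min (card (pverts G)) (card (pverts H)) \<longrightarrow>
            (if min_degree G + min_degree H < k - 1
             then pvc_k k (graph_join G H) = 2
             else pvc_k k (graph_join G H) = 1))"
proof -
  interpret graph_pair G H
    by (rule graph_pair.intro[OF assms(1,2)])
  \<comment> \<open>The bound \<open>< k - 1\<close> is the condition \<open>+ 1 < k\<close> of
    \<open>pvc_k_join_eq_2\<close>, and its negation is that of
    \<open>pvc_k_join_eq_1\<close>.\<close>
  have "pvc_k k (graph_join G H) = (if min_degree G + min_degree H < k - 1 then 2 else 1)"
    if "2 \<le> k" "k \<le> min (card (pverts G)) (card (pverts H))" for k
    using that pvc_k_join_eq_1[of k] pvc_k_join_eq_2[of k] by auto
  then show ?thesis
    using pvc_join[OF assms(3,4)] spvc_join[OF assms(3,4)] by simp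
qed

end
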